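(* Let $G$ and $G'$ be finite groups with $|G|=|G'|$, let $p$ be a $(G,G')$-invariant correlation with correlation matrix $D^p$, and let $X$ and $Y$ be digraphs. Let $B$ be the bipartite graph with vertex set the disjoint union $G\cup G'$ in which $x\in G$ and $y\in G'$ are adjacent if and only if $D^p_{x,y}\neq 0$. Let $V_1,\dots,V_k$ be the vertex sets of the connected components of $B$, put $C_i=G\cap V_i$ and $C_i'=G'\cap V_i$, and for $I\subseteq\{1,\dots,k\}$ put $C_I=\bigcup_{i\in I}C_i$ and $C_I'=\bigcup_{i\in I}C_i'$. Then $p$ wins the $(X,Y)$-isomorphism game if and only if there is some $I\subseteq\{1,\dots,k\}$ such that $X=\operatorname{Cay}(G,C_I)$ and $Y=\operatorname{Cay}(G',C_I')$.
   Context: Digraphs may have loops. For a subset $C\subseteq G$, $\operatorname{Cay}(G,C)$ is the digraph with vertex set $G$ and arc set $\{(g,gs):g\in G,\ s\in C\}$. A correlation (with inputs in $G'$ and outputs in $G$) is a function $p:G\times G\times G'\times G'\to\mathbb{R}_{\ge 0}$, written $p(b,d|a,c)$ with $b,d\in G$, $a,c\in G'$, such that $\sum_{b,d\in G}p(b,d|a,c)=1$ for all $a,c\in G'$. It is a winning correlation for the $(G,G')$-bijection game if $p(b,d|a,c)=0$ whenever exactly one of the equalities $b=d$, $a=c$ holds. A $(G,G')$-invariant correlation is a winning correlation $p$ for the $(G,G')$-bijection game such that $p(b,d|a,c)$ depends only on $b^{-1}d\in G$ and $a^{-1}c\in G'$, and $\sum_{a,c\in G'}p(b,d|a,c)=1$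 for all $b,d\in G$. Its correlation matrix is the $G\times G'$ matrix with $D^p_{x,y}=|G|\,p(b,d|a,c)$ for any $b,d\in G$, $a,c\in G'$ with $b^{-1}d=x$, $a^{-1}c=y$. The correlation $p$ wins the $(X,Y)$-isomorphism game if $V(X)=G$, $V(Y)=G'$, and $p(b,d|a,c)\ne 0$ implies: $b=d$ if and only if $a=c$; there is an arc from $b$ to $d$ in $X$ if and only if there is an arc from $a$ to $c$ in $Y$; and $b$ (respectively $d$) has a loop in $X$ if and only if $a$ (respectively $c$) has a loop in $Y$. *)

theory Defs
  imports Complex_Main "HOL-Algebra.Coset" "Graph_Theory.Digraph_Component"
begin

text \<open>
  Digraphs with loops and without parallel arcs are the \<^typ>\<open>'a pair_pre_digraph\<close>s of the
  digraph library satisfying \<^locale>\<open>pair_wf_digraph\<close> (arcs join vertices). Following that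
  library, an undirected graph is a symmetric digraph.
\<close>

definition Cay :: "('g, 'm) monoid_scheme \<Rightarrow> 'g set \<Rightarrow> 'g pair_pre_digraph" where
  "Cay G C = \<lparr> pverts = carrier G, parcs = {(g, g \<otimes>\<^bsub>G\<^esub> s) | g s. g \<in> carrier G \<and> s \<in> C} \<rparr>"

text \<open>
  The value \<open>p(b,d|a,c)\<close> is written \<open>p b d a c\<close>; values outside the carriers are irrelevant.
\<close>

type_synonym ('g, 'h) correlation = "'g \<Rightarrow> 'g \<Rightarrow> 'h \<Rightarrow> 'h \<Rightarrow> real"

definition is_correlation ::
  "('g, 'm) monoid_scheme \<Rightarrow> ('h, 'n) monoid_scheme \<Rightarrow> ('g, 'h) correlation \<Rightarrow> bool" where
  "is_correlation G G' p \<longleftrightarrow>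
     (\<forall>b\<in>carrier G. \<forall>d\<in>carrier G. \<forall>a\<in>carrier G'. \<forall>c\<in>carrier G'. 0 \<le> p b d a c) \<and>
     (\<forall>a\<in>carrier G'. \<forall>c\<in>carrier G'. (\<Sum>b\<in>carrier G. \<Sum>d\<in>carrier G. p b d a c) = 1)"

definition wins_bijection_game ::
  "('g, 'm) monoid_scheme \<Rightarrow> ('h, 'n) monoid_scheme \<Rightarrow> ('g, 'h) correlation \<Rightarrow> bool" where
  "wins_bijection_game G G' p \<longleftrightarrow>
     is_correlation G G' p \<and>
     (\<forall>b\<in>carrier G. \<forall>d\<in>carrier G. \<forall>a\<in>carrier G'. \<forall>c\<in>carrier G'.
        (b = d) \<noteq> (a = c) \<longrightarrow> p b d a c = 0)"

definition invariant_correlation ::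
  "('g, 'm) monoid_scheme \<Rightarrow> ('h, 'n) monoid_scheme \<Rightarrow> ('g, 'h) correlation \<Rightarrow> bool" where
  "invariant_correlation G G' p \<longleftrightarrow>
     wins_bijection_game G G' p \<and>
     (\<forall>b\<in>carrier G. \<forall>d\<in>carrier G. \<forall>b'\<in>carrier G. \<forall>d'\<in>carrier G.
      \<forall>a\<in>carrier G'. \<forall>c\<in>carrier G'. \<forall>a'\<in>carrier G'. \<forall>c'\<in>carrier G'.
        inv\<^bsub>G\<^esub> b \<otimes>\<^bsub>G\<^esub> d = inv\<^bsub>G\<^esub> b' \<otimes>\<^bsub>G\<^esub> d' \<longrightarrow>
        inv\<^bsub>G'\<^esub> a \<otimes>\<^bsub>G'\<^esub> c = inv\<^bsub>G'\<^esub> a' \<otimes>\<^bsub>G'\<^esub> c' \<longrightarrow>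
        p b d a c = p b' d' a' c') \<and>
     (\<forall>b\<in>carrier G. \<forall>d\<in>carrier G. (\<Sum>a\<in>carrier G'. \<Sum>c\<in>carrier G'. p b d a c) = 1)"

definition correlation_matrix ::
  "('g, 'm) monoid_scheme \<Rightarrow> ('h, 'n) monoid_scheme \<Rightarrow> ('g, 'h) correlation \<Rightarrow> 'g \<Rightarrow> 'h \<Rightarrow> real"
  where
  "correlation_matrix G G' p x y =
     (THE r. \<forall>b\<in>carrier G. \<forall>d\<in>carrier G. \<forall>a\<in>carrier G'. \<forall>c\<in>carrier G'.
        inv\<^bsub>G\<^esub> b \<otimes>\<^bsub>G\<^esub> d = x \<longrightarrow> inv\<^bsub>G'\<^esub> a \<otimes>\<^bsub>G'\<^esub> c = y \<longrightarrow> r = real (order G) * p b d a c)"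

text \<open>The description above denotes, for all \<open>x\<close> and \<open>y\<close> in the carriers.\<close>

lemma correlation_matrix_eq:
  assumes "invariant_correlation G G' p"
    and "b \<in> carrier G" "d \<in> carrier G" "a \<in> carrier G'" "c \<in> carrier G'"
  shows "correlation_matrix G G' p (inv\<^bsub>G\<^esub> b \<otimes>\<^bsub>G\<^esub> d) (inv\<^bsub>G'\<^esub> a \<otimes>\<^bsub>G'\<^esub> c) = real (order G) * p b d a c"
proof -
  have indep: "p b d a c = p b' d' a' c'"
    if "b' \<in> carrier G" "d' \<in> carrier G" "a' \<in> carrier G'" "c' \<in> carrier G'"
      "inv\<^bsub>G\<^esub> b' \<otimes>\<^bsub>G\<^esub> d' = inv\<^bsub>G\<^esub> b \<otimes>\<^bsub>G\<^esub> d" "inv\<^bsub>G'\<^esub> a' \<otimes>\<^bsub>G'\<^esub> c' = inv\<^bsub>G'\<^esub> a \<otimes>\<^bsub>G'\<^esub> c"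
    for b' d' a' c'
    using assms that unfolding invariant_correlation_def by metis
  show ?thesis
    unfolding correlation_matrix_def
  proof (rule the_equality)
    show "\<forall>b'\<in>carrier G. \<forall>d'\<in>carrier G. \<forall>a'\<in>carrier G'. \<forall>c'\<in>carrier G'.
        inv\<^bsub>G\<^esub> b' \<otimes>\<^bsub>G\<^esub> d' = inv\<^bsub>G\<^esub> b \<otimes>\<^bsub>G\<^esub> d \<longrightarrow> inv\<^bsub>G'\<^esub> a' \<otimes>\<^bsub>G'\<^esub> c' = inv\<^bsub>G'\<^esub> a \<otimes>\<^bsub>G'\<^esub> c \<longrightarrow>
        real (order G) * p b d a c = real (order G) * p b' d' a' c'"
      using indep by metis
  qed (use assms(2-5) in blast)
qed

definition wins_isomorphism_game ::
  "('g, 'm) monoid_scheme \<Rightarrow> ('h, 'n) monoid_scheme \<Rightarrow> ('g, 'h) correlation \<Rightarrow>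
   'g pair_pre_digraph \<Rightarrow> 'h pair_pre_digraph \<Rightarrow> bool" where
  "wins_isomorphism_game G G' p X Y \<longleftrightarrow>
     pverts X = carrier G \<and> pverts Y = carrier G' \<and>
     (\<forall>b\<in>carrier G. \<forall>d\<in>carrier G. \<forall>a\<in>carrier G'. \<forall>c\<in>carrier G'. p b d a c \<noteq> 0 \<longrightarrow>
        (b = d \<longleftrightarrow> a = c) \<and>
        ((b, d) \<in> parcs X \<longleftrightarrow> (a, c) \<in> parcs Y) \<and>
        ((b, b) \<in> parcs X \<longleftrightarrow> (a, a) \<in> parcs Y) \<and>
        ((d, d) \<in> parcs X \<longleftrightarrow> (c, c) \<in> parcs Y))"

definition support_graph ::
  "('g, 'm) monoid_scheme \<Rightarrow> ('h, 'n) monoid_scheme \<Rightarrow> ('g \<Rightarrow> 'h \<Rightarrow> real) \<Rightarrow>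
   ('g + 'h) pair_pre_digraph" where
  "support_graph G G' D =
     (let E = {(Inl x, Inr y) | x y. x \<in> carrier G \<and> y \<in> carrier G' \<and> D x y \<noteq> 0}
      in \<lparr> pverts = carrier G <+> carrier G', parcs = E \<union> E\<inverse> \<rparr>)"

text \<open>Connected components are the maximal connected subgraphs.\<close>

definition component_verts :: "'a pair_pre_digraph \<Rightarrow> 'a set set" where
  "component_verts B =
     {verts H | H. pre_digraph.max_subgraph (with_proj B) Digraph_Component.connected H}"

end

theory Submission
  imports Defs
begin

text \<open>
  Every row and column of \<open>D\<close> has a nonzero entry, because \<open>p\<close> sums to 1 over the inputs for fixed
  outputs and over the outputs for fixed inputs. If \<open>p\<close> wins and \<open>x\<close> is adjacent to \<open>y\<close> in \<open>B\<close>, then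
  each pair in \<open>G\<close> with quotient \<open>x\<close> is an arc of \<open>X\<close> exactly if each pair in \<open>G'\<close> with quotient \<open>y\<close> is an arc
  of \<open>Y\<close>. So both digraphs are Cayley digraphs, and membership in their connection sets is constant
  along the arcs of \<open>B\<close>, hence on components. For the loop condition of the converse, the identities
  of \<open>G\<close> and \<open>G'\<close> are adjacent in \<open>B\<close>: the bijection game allows them no other neighbours.
\<close>

section \<open>Components of symmetric digraphs\<close>

text \<open>Connectedness means strong connectedness of the symmetric closure, and closing a
  symmetric digraph adds no reachability.\<close>

lemma (in wf_digraph) connected_iff_strongly_connected:
  assumes "symmetric G"
  shows "Digraph_Component.connected G \<longleftrightarrow> strongly_connected G"
  using reachable_mk_symmetric_eq[OF assms]
  by (simp add: Digraph_Component.connected_def strongly_connected_def)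

text \<open>This is what makes maximal connected subgraphs induced.\<close>

lemma arc_mono_connected: "arc_mono Digraph_Component.connected"
  unfolding arc_mono_def
proof (intro allI impI, elim conjE)
  fix H K :: "('a, 'b) pre_digraph"
  assume H: "Digraph_Component.connected H" "subgraph H K" "verts H = verts K"
  then have "wf_digraph K" "spanning H K" by (auto simp: spanning_def)
  then show "Digraph_Component.connected K"
    using H(1) by (rule wf_digraph.connected_spanning_imp_connected)
qed

text \<open>The two notions agree on induced subgraphs, which inherit symmetry; an arbitrary
  subgraph can be connected without being strongly connected. Maximality closes the gap, and the
  theory of strong components becomes available.\<close>

lemma (in sym_digraph) max_subgraph_connected_eq:
  "max_subgraph Digraph_Component.connected H \<longleftrightarrow> max_subgraph strongly_connected H"
proof -
  have conn_iff: "Digraph_Component.connected K \<longleftrightarrow> strongly_connected K"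
    if "induced_subgraph K G" for K
    using wf_digraphI_induced[OF that] induced_graph_imp_symmetric[OF sym_arcs that]
    by (rule wf_digraph.connected_iff_strongly_connected)
  have sc_conn: "Digraph_Component.connected K" if "subgraph K G" "strongly_connected K" for K
  proof -
    interpret K: wf_digraph K using that(1) by (rule subgraphE)
    show ?thesis
      using that(2) K.reachable_mk_symmetricI
      unfolding Digraph_Component.connected_def strongly_connected_def with_proj_simps
        pverts_mk_symmetric by blast
  qed
  show ?thesis
  proof
    assume max: "max_subgraph Digraph_Component.connected H"
    have ind: "induced_subgraph H G"
      by (rule induced_subgraphI_arc_mono[OF max arc_mono_connected])
    show "max_subgraph strongly_connected H"
    proof (rule max_subgraphI)
      show "strongly_connected H" using max_subgraph_prop[OF max] conn_iff[OF ind] by blast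
      show "subgraph H G" using max by (rule subgraphI_max_subgraph)
      show "\<not> strongly_connected K" if "H \<noteq> K" "subgraph H K" "subgraph K G" for K
        using max that sc_conn[OF that(3)] unfolding max_subgraph_def by metis
    qed
  next
    assume max: "max_subgraph strongly_connected H"
    show "max_subgraph Digraph_Component.connected H"
    proof (rule max_subgraphI)
      show sub: "subgraph H G" using max by (rule subgraphI_max_subgraph)
      show "Digraph_Component.connected H" using sub max_subgraph_prop[OF max] by (rule sc_conn)
      fix K assume K: "H \<noteq> K" "subgraph H K" "subgraph K G"
      \<comment> \<open>\<open>K\<close> itself may fail to be symmetric, so it is enlarged to the
        induced subgraph on its vertices. Maximality of \<open>H\<close> then gives
        \<open>?K = H\<close>, and \<open>K\<close>, lying between the two, equals
        \<open>H\<close>.\<close>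
      let ?K = "G \<restriction> verts K"
      have ind: "induced_subgraph ?K G"
        by (rule induced_induce[OF subgraph_imp_subverts[OF K(3)]])
      have sub_ind: "subgraph K ?K" using K(3) by (rule subgraph_induce_subgraphI2)
      show "\<not> Digraph_Component.connected K"
      proof
        assume conn: "Digraph_Component.connected K"
        have "Digraph_Component.connected ?K"
          by (rule arc_mono_connected[unfolded arc_mono_def, rule_format, of K])
            (simp add: conn sub_ind)
        then have sc: "strongly_connected ?K" using conn_iff[OF ind] by blast
        have "subgraph H ?K" using K(2) sub_ind by (rule subgraph_trans)
        then have eq: "?K = H"
          using max[unfolded max_subgraph_def] induced_imp_subgraph[OF ind] sc by blast
        then have "verts H = verts K" by (metis induce_subgraph_verts)
        moreover have "arcs H = arcs K"
          using K(2) sub_ind unfolding eq by (auto simp: subgraph_def)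
        ultimately have "H = K"
          using K(2) by (intro pre_digraph.equality) (auto simp: subgraph_def compatible_def)
        then show False using K(1) by contradiction
      qed
    qed
  qed
qed

text \<open>Components become classes of mutual reachability, the form in which they are used
  below.\<close>

lemma (in pair_sym_digraph) component_verts_eq_sccs_verts: "component_verts G = sccs_verts"
  unfolding component_verts_def max_subgraph_connected_eq sccs_verts_conv sccs_altdef2
  by auto

lemma (in pair_sym_digraph) component_verts_adj:
  assumes S: "S \<in> component_verts G" and arc: "(u, v) \<in> parcs G"
  shows "u \<in> S \<longleftrightarrow> v \<in> S"
proof -
  have "u \<rightarrow>\<^sup>*\<^bsub>G\<^esub> v" using arc by (simp add: reachable_adjI)
  moreover have "v \<rightarrow>\<^sup>*\<^bsub>G\<^esub> u" using symmetric_reachable[OF pair_sym_arcs] calculation .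
  ultimately show ?thesis
    using S unfolding component_verts_eq_sccs_verts sccs_verts_def by blast
qed

lemma (in pair_sym_digraph) component_verts_const:
  assumes S: "S \<in> component_verts G"
    and P: "\<And>u v. (u, v) \<in> parcs G \<Longrightarrow> P u \<longleftrightarrow> P v"
    and uv: "u \<in> S" "v \<in> S"
  shows "P u \<longleftrightarrow> P v"
proof -
  have "u \<rightarrow>\<^sup>*\<^bsub>G\<^esub> v"
    using S uv unfolding component_verts_eq_sccs_verts sccs_verts_def by blast
  then have "(u, v) \<in> (parcs G)\<^sup>*" using reachable_rtranclI by fastforce
  then show ?thesis by (induction rule: rtrancl_induct) (simp_all add: P)
qed

lemma (in pair_sym_digraph) component_verts_cover:
  assumes "u \<in> pverts G"
  obtains S where "S \<in> component_verts G" "u \<in> S"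
proof
  \<comment> \<open>By symmetry, whatever is reachable from \<open>u\<close> also reaches
    \<open>u\<close>.\<close>
  show "{v. u \<rightarrow>\<^sup>*\<^bsub>G\<^esub> v} \<in> component_verts G"
    using induce_reachable_is_in_sccs[of u] assms
    unfolding component_verts_eq_sccs_verts sccs_verts_conv
    by (force intro: rev_image_eqI)
  show "u \<in> {v. u \<rightarrow>\<^sup>*\<^bsub>G\<^esub> v}" using assms by simp
qed

text \<open>Source of the index set in the forward direction: since \<open>P\<close> is constant on
  components, the indices of those containing some vertex with \<open>P\<close> suffice.\<close>

lemma (in pair_sym_digraph) adj_invariant_eq_Union_components:
  assumes V: "V ` K = component_verts G"
    and P: "\<And>u v. (u, v) \<in> parcs G \<Longrightarrow> P u \<longleftrightarrow> P v"
  obtains I where "I \<subseteq> K" "\<And>u. u \<in> pverts G \<Longrightarrow> P u \<longleftrightarrow> (\<exists>i\<in>I. u \<in> V i)"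
proof
  let ?I = "{i \<in> K. \<exists>u\<in>V i. P u}"
  show "?I \<subseteq> K" by blast
  fix u assume "u \<in> pverts G"
  then obtain j where "j \<in> K" "u \<in> V j" using component_verts_cover V by (metis imageE)
  moreover have "P u" if "i \<in> ?I" "u \<in> V i" for i
    using that V component_verts_const[of "V i" P u] P by blast
  ultimately show "P u \<longleftrightarrow> (\<exists>i\<in>?I. u \<in> V i)" by blast
qed

lemma pair_sym_digraph_support_graph: "pair_sym_digraph (support_graph G G' D)"
  by unfold_locales (auto simp: support_graph_def symmetric_def Let_def intro!: symI)

section \<open>Cayley digraphs\<close>

lemma pverts_Cay [simp]: "pverts (Cay G C) = carrier G"
  by (simp add: Cay_def)

text \<open>By left cancellation, \<open>inv b \<otimes> d\<close> is the only carrier element whose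
  right multiplication takes \<open>b\<close> to \<open>d\<close>.\<close>

lemma (in group) parcs_Cay_iff:
  assumes "b \<in> carrier G" "d \<in> carrier G" "C \<subseteq> carrier G"
  shows "(b, d) \<in> parcs (Cay G C) \<longleftrightarrow> inv b \<otimes> d \<in> C"
proof -
  have "b \<otimes> (inv b \<otimes> d) = d" using assms by (simp add: m_assoc[symmetric])
  moreover have "inv b \<otimes> (b \<otimes> s) = s" if "s \<in> C" for s
    using assms that by (auto simp: m_assoc[symmetric])
  ultimately show ?thesis using assms unfolding Cay_def by force
qed

text \<open>Left translation moves every arc to one leaving the identity without changing its
  quotient, so the out-neighbours of \<open>\<one>\<close> form the connection set.\<close>

lemma (in group) eq_Cay:
  assumes wf: "pair_wf_digraph X" and verts: "pverts X = carrier G"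
    and inv: "\<And>b d b' d'. \<lbrakk>b \<in> carrier G; d \<in> carrier G; b' \<in> carrier G; d' \<in> carrier G;
      inv b \<otimes> d = inv b' \<otimes> d'\<rbrakk> \<Longrightarrow> (b, d) \<in> parcs X \<longleftrightarrow> (b', d') \<in> parcs X"
  shows "X = Cay G {x \<in> carrier G. (\<one>, x) \<in> parcs X}"
proof -
  interpret X: pair_wf_digraph X by (rule wf)
  define C where "C = {x \<in> carrier G. (\<one>, x) \<in> parcs X}"
  have C: "C \<subseteq> carrier G" by (auto simp: C_def)
  have arc: "(b, d) \<in> parcs X \<longleftrightarrow> (b, d) \<in> parcs (Cay G C)"
    if bd: "b \<in> carrier G" "d \<in> carrier G" for b d
  proof -
    have "(b, d) \<in> parcs X \<longleftrightarrow> (\<one>, inv b \<otimes> d) \<in> parcs X"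
      using bd by (intro inv) simp_all
    also have "\<dots> \<longleftrightarrow> inv b \<otimes> d \<in> C" using bd by (simp add: C_def)
    also have "\<dots> \<longleftrightarrow> (b, d) \<in> parcs (Cay G C)" using bd C by (simp add: parcs_Cay_iff)
    finally show ?thesis .
  qed
  \<comment> \<open>Neither digraph has arcs outside the carrier, so agreement on the carrier gives
    equality.\<close>
  have "parcs X \<subseteq> carrier G \<times> carrier G" using verts X.wellformed' by auto
  moreover have "parcs (Cay G C) \<subseteq> carrier G \<times> carrier G" using C by (auto simp: Cay_def)
  ultimately have "parcs X = parcs (Cay G C)" using arc by blast
  then show ?thesis using verts unfolding C_def[symmetric]
    by (intro pair_pre_digraph.equality) simp_all
qed

section \<open>Invariant correlations\<close>

lemma invariant_correlation_cong:
  assumes "invariant_correlation G G' p"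
    and "b \<in> carrier G" "d \<in> carrier G" "b' \<in> carrier G" "d' \<in> carrier G"
    and "a \<in> carrier G'" "c \<in> carrier G'" "a' \<in> carrier G'" "c' \<in> carrier G'"
    and "inv\<^bsub>G\<^esub> b \<otimes>\<^bsub>G\<^esub> d = inv\<^bsub>G\<^esub> b' \<otimes>\<^bsub>G\<^esub> d'"
    and "inv\<^bsub>G'\<^esub> a \<otimes>\<^bsub>G'\<^esub> c = inv\<^bsub>G'\<^esub> a' \<otimes>\<^bsub>G'\<^esub> c'"
  shows "p b d a c = p b' d' a' c'"
  using assms(1)[unfolded invariant_correlation_def, THEN conjunct2, THEN conjunct1,
      THEN bspec, OF assms(2), THEN bspec, OF assms(3), THEN bspec, OF assms(4),
      THEN bspec, OF assms(5), THEN bspec, OF assms(6), THEN bspec, OF assms(7),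
      THEN bspec, OF assms(8), THEN bspec, OF assms(9)] assms(10,11)
  by simp

lemma invariant_correlation_wins_bijection_game:
  "invariant_correlation G G' p \<Longrightarrow> wins_bijection_game G G' p"
  unfolding invariant_correlation_def by (elim conjE)

lemma invariant_correlation_row_nonzero:
  assumes "invariant_correlation G G' p" "b \<in> carrier G" "d \<in> carrier G"
  obtains a c where "a \<in> carrier G'" "c \<in> carrier G'" "p b d a c \<noteq> 0"
proof -
  have "(\<Sum>a\<in>carrier G'. \<Sum>c\<in>carrier G'. p b d a c) \<noteq> 0"
    using assms(1)[unfolded invariant_correlation_def, THEN conjunct2, THEN conjunct2] assms(2,3)
    by simp
  then show ?thesis using that by (meson sum.not_neutral_contains_not_neutral)
qed

lemma invariant_correlation_col_nonzero:
  assumes "invariant_correlation G G' p" "a \<in> carrier G'" "c \<in> carrier G'"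
  obtains b d where "b \<in> carrier G" "d \<in> carrier G" "p b d a c \<noteq> 0"
proof -
  have "(\<Sum>b\<in>carrier G. \<Sum>d\<in>carrier G. p b d a c) \<noteq> 0"
    using invariant_correlation_wins_bijection_game[OF assms(1)] assms(2,3)
    by (simp add: wins_bijection_game_def is_correlation_def)
  then show ?thesis using that by (meson sum.not_neutral_contains_not_neutral)
qed

lemma invariant_correlation_eq_iff:
  assumes "invariant_correlation G G' p"
    and "b \<in> carrier G" "d \<in> carrier G" "a \<in> carrier G'" "c \<in> carrier G'" "p b d a c \<noteq> 0"
  shows "b = d \<longleftrightarrow> a = c"
  using invariant_correlation_wins_bijection_game[OF assms(1)] assms(2-)
  unfolding wins_bijection_game_def by blast

section \<open>Arcs of the support graph\<close>

lemma support_graph_arc: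
  assumes "group G" "group G'" "finite (carrier G)" "invariant_correlation G G' p"
    and "b \<in> carrier G" "d \<in> carrier G" "a \<in> carrier G'" "c \<in> carrier G'" "p b d a c \<noteq> 0"
  shows "(Inl (inv\<^bsub>G\<^esub> b \<otimes>\<^bsub>G\<^esub> d), Inr (inv\<^bsub>G'\<^esub> a \<otimes>\<^bsub>G'\<^esub> c))
    \<in> parcs (support_graph G G' (correlation_matrix G G' p))"
proof -
  interpret G: group G by fact
  interpret G': group G' by fact
  \<comment> \<open>Finiteness makes the factor \<open>order G\<close> positive.\<close>
  have "correlation_matrix G G' p (inv\<^bsub>G\<^esub> b \<otimes>\<^bsub>G\<^esub> d) (inv\<^bsub>G'\<^esub> a \<otimes>\<^bsub>G'\<^esub> c) \<noteq> 0"
    using assms G.order_gt_0_iff_finite by (simp add: correlation_matrix_eq)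
  then show ?thesis using assms by (simp add: support_graph_def Let_def)
qed

text \<open>The entry at \<open>x\<close>, \<open>y\<close> is read off at the representatives
  \<open>(\<one>, x)\<close> and \<open>(\<one>, y)\<close>, which match connection sets taken as
  out-neighbours of the identities. Each edge occurs in both orientations.\<close>

lemma support_graph_arcE:
  assumes "group G" "group G'" "invariant_correlation G G' p"
    and "(u, v) \<in> parcs (support_graph G G' (correlation_matrix G G' p))"
  obtains x y where "x \<in> carrier G" "y \<in> carrier G'" "p \<one>\<^bsub>G\<^esub> x \<one>\<^bsub>G'\<^esub> y \<noteq> 0"
    "(u, v) = (Inl x, Inr y) \<or> (u, v) = (Inr y, Inl x)"
proof -
  interpret G: group G by fact
  interpret G': group G' by fact
  from assms(4) obtain x y where xy: "x \<in> carrier G" "y \<in> carrier G'"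
    "correlation_matrix G G' p x y \<noteq> 0" "(u, v) = (Inl x, Inr y) \<or> (u, v) = (Inr y, Inl x)"
    by (auto simp: support_graph_def Let_def)
  moreover have "correlation_matrix G G' p x y = real (order G) * p \<one>\<^bsub>G\<^esub> x \<one>\<^bsub>G'\<^esub> y"
    using correlation_matrix_eq[OF assms(3), of "\<one>\<^bsub>G\<^esub>" x "\<one>\<^bsub>G'\<^esub>" y] xy by simp
  ultimately show ?thesis using that by auto
qed

section \<open>Winning the isomorphism game\<close>

lemma wins_isomorphism_game_arc_iff:
  assumes "wins_isomorphism_game G G' p X Y"
    and "b \<in> carrier G" "d \<in> carrier G" "a \<in> carrier G'" "c \<in> carrier G'" "p b d a c \<noteq> 0"
  shows "(b, d) \<in> parcs X \<longleftrightarrow> (a, c) \<in> parcs Y"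
  using assms unfolding wins_isomorphism_game_def by blast

text \<open>By invariance, inputs \<open>a\<close>, \<open>c\<close> of nonzero value for one pair
  have nonzero value for the other, so both pairs are compared with the same \<open>(a, c)\<close>
  in \<open>Y\<close>.\<close>

lemma wins_isomorphism_game_arc_cong_left:
  assumes "invariant_correlation G G' p" "wins_isomorphism_game G G' p X Y"
    and "b \<in> carrier G" "d \<in> carrier G" "b' \<in> carrier G" "d' \<in> carrier G"
    and "inv\<^bsub>G\<^esub> b \<otimes>\<^bsub>G\<^esub> d = inv\<^bsub>G\<^esub> b' \<otimes>\<^bsub>G\<^esub> d'"
  shows "(b, d) \<in> parcs X \<longleftrightarrow> (b', d') \<in> parcs X"
proof -
  obtain a c where ac: "a \<in> carrier G'" "c \<in> carrier G'" "p b d a c \<noteq> 0"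
    using invariant_correlation_row_nonzero[OF assms(1,3,4)] by blast
  moreover have "p b d a c = p b' d' a c"
    by (rule invariant_correlation_cong[OF assms(1)]) (use assms(3-7) ac in simp_all)
  ultimately show ?thesis using wins_isomorphism_game_arc_iff[OF assms(2)] assms(3-6) by metis
qed

lemma wins_isomorphism_game_arc_cong_right:
  assumes "invariant_correlation G G' p" "wins_isomorphism_game G G' p X Y"
    and "a \<in> carrier G'" "c \<in> carrier G'" "a' \<in> carrier G'" "c' \<in> carrier G'"
    and "inv\<^bsub>G'\<^esub> a \<otimes>\<^bsub>G'\<^esub> c = inv\<^bsub>G'\<^esub> a' \<otimes>\<^bsub>G'\<^esub> c'"
  shows "(a, c) \<in> parcs Y \<longleftrightarrow> (a', c') \<in> parcs Y"
proof -
  obtain b d where bd: "b \<in> carrier G" "d \<in> carrier G" "p b d a c \<noteq> 0"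
    using invariant_correlation_col_nonzero[OF assms(1,3,4)] by blast
  moreover have "p b d a c = p b d a' c'"
    by (rule invariant_correlation_cong[OF assms(1)]) (use assms(3-7) bd in simp_all)
  ultimately show ?thesis using wins_isomorphism_game_arc_iff[OF assms(2)] assms(3-6) by metis
qed

text \<open>A Cayley digraph has loops at all vertices or at none, according to whether the identity
  is in its connection set. Both loop conditions thus become
  \<open>\<one> \<in> C \<longleftrightarrow> \<one> \<in> C'\<close>.\<close>

lemma wins_isomorphism_game_Cay:
  assumes G: "group G" and G': "group G'" and inv: "invariant_correlation G G' p"
    and C: "C \<subseteq> carrier G" and C': "C' \<subseteq> carrier G'"
    and adj: "\<And>b d a c. \<lbrakk>b \<in> carrier G; d \<in> carrier G; a \<in> carrier G'; c \<in> carrier G';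
      p b d a c \<noteq> 0\<rbrakk> \<Longrightarrow> inv\<^bsub>G\<^esub> b \<otimes>\<^bsub>G\<^esub> d \<in> C \<longleftrightarrow> inv\<^bsub>G'\<^esub> a \<otimes>\<^bsub>G'\<^esub> c \<in> C'"
  shows "wins_isomorphism_game G G' p (Cay G C) (Cay G' C')"
proof -
  interpret G: group G by fact
  interpret G': group G' by fact
  \<comment> \<open>Equal outputs force equal inputs, so \<open>adj\<close> at this quadruple
    compares the two identities.\<close>
  obtain a c where ac: "a \<in> carrier G'" "c \<in> carrier G'" "p \<one>\<^bsub>G\<^esub> \<one>\<^bsub>G\<^esub> a c \<noteq> 0"
    using invariant_correlation_row_nonzero[OF inv] by (metis G.one_closed)
  then have "a = c" using invariant_correlation_eq_iff[OF inv] by (metis G.one_closed)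
  then have "\<one>\<^bsub>G\<^esub> \<in> C \<longleftrightarrow> \<one>\<^bsub>G'\<^esub> \<in> C'"
    using adj[OF G.one_closed G.one_closed ac] ac by simp
  then show ?thesis
    unfolding wins_isomorphism_game_def
    using adj invariant_correlation_eq_iff[OF inv]
    by (simp add: G.parcs_Cay_iff[OF _ _ C] G'.parcs_Cay_iff[OF _ _ C'])
qed

theorem theorem3p17:
  fixes G :: "('g, 'm) monoid_scheme" and G' :: "('h, 'n) monoid_scheme"
    and p :: "('g, 'h) correlation"
    and X :: "'g pair_pre_digraph" and Y :: "'h pair_pre_digraph"
    and B :: "('g + 'h) pair_pre_digraph"
    and V :: "nat \<Rightarrow> ('g + 'h) set" and k :: nat
    and C :: "nat \<Rightarrow> 'g set" and C' :: "nat \<Rightarrow> 'h set"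
  assumes "group G" and "group G'"
    and "finite (carrier G)" and "finite (carrier G')"
    and "order G = order G'"
    and "invariant_correlation G G' p"
    and "pair_wf_digraph X" and "pair_wf_digraph Y"
    and "B = support_graph G G' (correlation_matrix G G' p)"
    and "bij_betw V {1..k} (component_verts B)"
    and "\<And>i. i \<in> {1..k} \<Longrightarrow> C i = {x \<in> carrier G. Inl x \<in> V i}"
    and "\<And>i. i \<in> {1..k} \<Longrightarrow> C' i = {y \<in> carrier G'. Inr y \<in> V i}"
  shows "wins_isomorphism_game G G' p X Y \<longleftrightarrow>
    (\<exists>I \<subseteq> {1..k}. X = Cay G (\<Union>i\<in>I. C i) \<and> Y = Cay G' (\<Union>i\<in>I. C' i))"
proof -
  interpret G: group G by fact
  interpret G': group G' by fact
  interpret B: pair_sym_digraph B unfolding assms(9) by (rule pair_sym_digraph_support_graph)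
  note p = assms(6)
  have V: "V ` {1..k} = component_verts B" using assms(10) by (simp add: bij_betw_def)
  have verts_B: "pverts B = carrier G <+> carrier G'"
    by (simp add: assms(9) support_graph_def Let_def)
  have C_Un: "(\<Union>i\<in>I. C i) = {x \<in> carrier G. \<exists>i\<in>I. Inl x \<in> V i}"
    and C'_Un: "(\<Union>i\<in>I. C' i) = {y \<in> carrier G'. \<exists>i\<in>I. Inr y \<in> V i}" if "I \<subseteq> {1..k}" for I
    using assms(11,12)[OF subsetD[OF that]] by auto
  show ?thesis
  proof
    assume win: "wins_isomorphism_game G G' p X Y"
    have X: "X = Cay G {x \<in> carrier G. (\<one>\<^bsub>G\<^esub>, x) \<in> parcs X}"
    proof (rule G.eq_Cay[OF assms(7)])
      show "pverts X = carrier G" using win by (simp add: wins_isomorphism_game_def)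
    qed (rule wins_isomorphism_game_arc_cong_left[OF p win])
    have Y: "Y = Cay G' {y \<in> carrier G'. (\<one>\<^bsub>G'\<^esub>, y) \<in> parcs Y}"
    proof (rule G'.eq_Cay[OF assms(8)])
      show "pverts Y = carrier G'" using win by (simp add: wins_isomorphism_game_def)
    qed (rule wins_isomorphism_game_arc_cong_right[OF p win])
    \<comment> \<open>Both connection sets are joined into one predicate on the vertices of
      \<open>B\<close>, so that a single \<open>I\<close> describes them both.\<close>
    define P where "P = case_sum (\<lambda>x. (\<one>\<^bsub>G\<^esub>, x) \<in> parcs X) (\<lambda>y. (\<one>\<^bsub>G'\<^esub>, y) \<in> parcs Y)"
    have P_adj: "P u \<longleftrightarrow> P v" if uv_arc: "(u, v) \<in> parcs B" for u v
    proof -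
      obtain x y where xy: "x \<in> carrier G" "y \<in> carrier G'" "p \<one>\<^bsub>G\<^esub> x \<one>\<^bsub>G'\<^esub> y \<noteq> 0"
        and uv: "(u, v) = (Inl x, Inr y) \<or> (u, v) = (Inr y, Inl x)"
        using support_graph_arcE[OF assms(1,2) p uv_arc[unfolded assms(9)]] .
      have "(\<one>\<^bsub>G\<^esub>, x) \<in> parcs X \<longleftrightarrow> (\<one>\<^bsub>G'\<^esub>, y) \<in> parcs Y"
        using xy by (intro wins_isomorphism_game_arc_iff[OF win]) simp_all
      then show ?thesis using uv by (auto simp: P_def)
    qed
    obtain I where I: "I \<subseteq> {1..k}" "\<And>u. u \<in> pverts B \<Longrightarrow> P u \<longleftrightarrow> (\<exists>i\<in>I. u \<in> V i)"
      using B.adj_invariant_eq_Union_components[of V "{1..k}" P] V P_adj by blast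
    have C_I: "(\<Union>i\<in>I. C i) = {x \<in> carrier G. (\<one>\<^bsub>G\<^esub>, x) \<in> parcs X}"
      using I(2)[of "Inl _"] by (auto simp: C_Un[OF I(1)] verts_B P_def)
    have C'_I: "(\<Union>i\<in>I. C' i) = {y \<in> carrier G'. (\<one>\<^bsub>G'\<^esub>, y) \<in> parcs Y}"
      using I(2)[of "Inr _"] by (auto simp: C'_Un[OF I(1)] verts_B P_def)
    have "X = Cay G (\<Union>i\<in>I. C i)" unfolding C_I by (rule X)
    moreover have "Y = Cay G' (\<Union>i\<in>I. C' i)" unfolding C'_I by (rule Y)
    ultimately show "\<exists>I\<subseteq>{1..k}. X = Cay G (\<Union>i\<in>I. C i) \<and> Y = Cay G' (\<Union>i\<in>I. C' i)"
      using I(1) by blast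
  next
    assume "\<exists>I\<subseteq>{1..k}. X = Cay G (\<Union>i\<in>I. C i) \<and> Y = Cay G' (\<Union>i\<in>I. C' i)"
    then obtain I where I: "I \<subseteq> {1..k}" and X: "X = Cay G (\<Union>i\<in>I. C i)"
      and Y: "Y = Cay G' (\<Union>i\<in>I. C' i)" by blast
    show "wins_isomorphism_game G G' p X Y"
      unfolding X Y
    proof (rule wins_isomorphism_game_Cay[OF assms(1,2) p])
      fix b d a c
      assume bdac: "b \<in> carrier G" "d \<in> carrier G" "a \<in> carrier G'" "c \<in> carrier G'"
        "p b d a c \<noteq> 0"
      let ?x = "inv\<^bsub>G\<^esub> b \<otimes>\<^bsub>G\<^esub> d" and ?y = "inv\<^bsub>G'\<^esub> a \<otimes>\<^bsub>G'\<^esub> c"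
      have "(Inl ?x, Inr ?y) \<in> parcs B"
        unfolding assms(9) using assms(1-3) p bdac by (rule support_graph_arc)
      \<comment> \<open>An arc of \<open>B\<close> never leaves a component.\<close>
      then have "Inl ?x \<in> V i \<longleftrightarrow> Inr ?y \<in> V i" if "i \<in> I" for i
        using that I V B.component_verts_adj by blast
      then show "?x \<in> (\<Union>i\<in>I. C i) \<longleftrightarrow> ?y \<in> (\<Union>i\<in>I. C' i)"
        using bdac by (simp add: C_Un[OF I] C'_Un[OF I])
    qed (auto simp: C_Un[OF I] C'_Un[OF I])
  qed
qed

end
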